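(* Let $X_n$ be any of $A_n,B_n,C_n,D_n,E_{6,7,8},F_4,G_2$. Fix $1\le a_0\le n$ and $j_0\in\mathbb Z_{\ge1}$ arbitrarily. Given any $\lambda\in\overline P^+$ and $W=\bigotimes_{1\le a\le n}\bigotimes_{j\ge1}(W^{(a)}_j)^{\otimes\nu^{(a)}_j}$, set $$W_1=W^{(a_0)}_{j_0}\otimes W^{(a_0)}_{j_0}\otimes W,\qquad W_2=W^{(a_0)}_{j_0+1}\otimes W^{(a_0)}_{j_0-1}\otimes W,$$ $$W_3=\bigotimes_{b\sim a_0}\ \bigotimes_{k=0}^{-C_{a_0b}-1}W^{(b)}_{\left[(C_{ba_0}j_0-k)/C_{a_0b}\right]}\otimes W,$$ where factors $W^{(b)}_0$ are to be omitted (trivial). Then $$M(W_1,\lambda,q)=M(W_2,\lambda,q)+q^{-\theta}M(W_3,\lambda,q),$$ $$M_l(W_1,q)=M_l(W_2,q)+q^{-\theta}M_l(W_3,q),$$ $$N_l(W_1,\lambda,q)=N_l(W_2,\lambda,q)+q^{-\theta}N_l(W_3,\lambda,q),$$ $$\theta=j_0+\sum_{k\ge1}\nu^{(a_0)}_k\min(j_0,k),$$ where in the second and third relations $l\in\mathbb Z_{\ge1}$ and it is assumed that $0\le j\le t_al$ for all $W^{(a)}_j$'s contained in $W_1,W_2$ and $W_3$.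
   Context: Lie algebra notation. $X_n$ is one of $A_n\,(n\ge1)$, $B_n\,(n\ge2)$, $C_n\,(n\ge2)$, $D_n\,(n\ge4)$, $E_{6,7,8},F_4,G_2$. $\alpha_a,\overline\Lambda_a$ ($1\le a\le n$) are simple roots and fundamental weights; $\overline P=\bigoplus_a\mathbb Z\overline\Lambda_a$, $\overline P^+=\bigoplus_a\mathbb Z_{\ge0}\overline\Lambda_a$. The form $(\cdot|\cdot)$ is normalized so that long roots have square length $2$; $t_a=2/(\alpha_a|\alpha_a)$; $C_{ab}=t_a(\alpha_a|\alpha_b)$ (Cartan matrix); $a\sim b$ means $C_{ab}<0$; $[x]$ is the largest integer not exceeding $x$. $q$-binomials. For $m\in\mathbb Z_{\ge0}$, $p\in\mathbb Z$, $$\left\{{p+m\atop m}\right\}_q=\frac{(q^{p+1})_\infty(q^{m+1})_\infty}{(q)_\infty(q^{p+m+1})_\infty}=\prod_{i=1}^m\frac{1-q^{p+i}}{1-q^i},\qquad\left[{p+m\atop m}\right]_q=\begin{cases}\left\{{p+m\atop m}\right\}_q&p\ge0\\0&p<0,\end{cases}$$ $(x)_\infty=\prod_{j\ge0}(1-xq^j)$. Fermionic forms. The symbol $W=\bigotimes_{a=1}^n\bigotimes_{j\ge1}(W^{(a)}_j)^{\otimes\nu^{(a)}_j}$ records data $\nu^{(a)}_j\in\mathbb Z_{\ge0}$, finitely many non-zero. For $\lambda\in\overline P$, $$M(W,\lambda,q)=\sum_{\{m\}}q^{c(\{m\})}\prod_{1\le a\le n,\,i\ge1}\left[{p^{(a)}_i+m^{(a)}_i\atop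 m^{(a)}_i}\right]_q,$$ $$c(\{m\})=\tfrac12\sum_{a,b}(\alpha_a|\alpha_b)\sum_{j,k\ge1}\min(t_bj,t_ak)m^{(a)}_jm^{(b)}_k-\sum_a\sum_{j,k\ge1}\nu^{(a)}_j\min(j,k)m^{(a)}_k,$$ $$p^{(a)}_i=\sum_{j\ge1}\nu^{(a)}_j\min(i,j)-\sum_b(\alpha_a|\alpha_b)\sum_{k\ge1}\min(t_bi,t_ak)m^{(b)}_k,$$ summed over $m^{(a)}_i\in\mathbb Z_{\ge0}$ with all $p^{(a)}_i\ge0$ and $\sum_{a,i}i\,m^{(a)}_i\alpha_a=\sum_{a,i}i\,\nu^{(a)}_i\overline\Lambda_a-\lambda$. For $l\in\mathbb Z_{\ge1}$ let $H_l=\{(a,j)\mid1\le a\le n,\ 1\le j\le t_al\}$. For $W=\bigotimes_{(a,j)\in H_l}(W^{(a)}_j)^{\otimes\nu^{(a)}_j}$ let $c_l$ and $p^{(a)}_i$ ($(a,i)\in H_l$) be given by the same formulas with all sums over $(a,j),(b,k)$ restricted to $H_l$, and define $$M_l(W,q)=\sum_{\{m\}}q^{c_l(\{m\})}\prod_{(a,i)\in H_l}\left[{p^{(a)}_i+m^{(a)}_i\atop m^{(a)}_i}\right]_q,\qquad N_l(W,\lambda,q)=\sum_{\{m\}}q^{c_l(\{m\})}\prod_{(a,i)\in H_l}\left\{{p^{(a)}_i+m^{(a)}_i\atop m^{(a)}_i}\right\}_q.$$ In $M_l$ the sum is over $\{m^{(a)}_i\in\mathbb Z_{\ge0}\mid(a,i)\in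 H_l\}$ with all $p^{(a)}_i\ge0$ and $\sum_{(a,i)\in H_l}i\,m^{(a)}_i\alpha_a=\sum_{(a,i)\in H_l}i\,\nu^{(a)}_i\overline\Lambda_a$; in $N_l$ it is over $\{m^{(a)}_i\in\mathbb Z_{\ge0}\mid(a,i)\in H_l\}$ with $\sum_{(a,i)\in H_l}i\,m^{(a)}_i\alpha_a=\sum_{(a,i)\in H_l}i\,\nu^{(a)}_i\overline\Lambda_a-\lambda$ and no sign condition on $p^{(a)}_i$. *)

theory Defs
  imports Complex_Main "HOL-Library.Multiset"
begin

datatype lie_type =
  Type_A nat | Type_B nat | Type_C nat | Type_D nat | Type_E nat | Type_F4 | Type_G2

fun rank :: "lie_type \<Rightarrow> nat" where
  "rank (Type_A n) = n"
| "rank (Type_B n) = n"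
| "rank (Type_C n) = n"
| "rank (Type_D n) = n"
| "rank (Type_E n) = n"
| "rank Type_F4 = 4"
| "rank Type_G2 = 2"

fun valid_type :: "lie_type \<Rightarrow> bool" where
  "valid_type (Type_A n) \<longleftrightarrow> n \<ge> 1"
| "valid_type (Type_B n) \<longleftrightarrow> n \<ge> 2"
| "valid_type (Type_C n) \<longleftrightarrow> n \<ge> 2"
| "valid_type (Type_D n) \<longleftrightarrow> n \<ge> 4"
| "valid_type (Type_E n) \<longleftrightarrow> n \<in> {6, 7, 8}"
| "valid_type Type_F4 \<longleftrightarrow> True"
| "valid_type Type_G2 \<longleftrightarrow> True"

definition nodes :: "lie_type \<Rightarrow> nat set" where
  "nodes X = {1..rank X}"

text \<open>
  Bonds of the Dynkin diagram in Bourbaki's labelling (for type G the node 1 is the long one),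
  each listed once with the smaller label first.
\<close>

fun bond :: "lie_type \<Rightarrow> nat \<Rightarrow> nat \<Rightarrow> bool" where
  "bond (Type_D n) a b \<longleftrightarrow> (b = a + 1 \<and> b < n) \<or> (a = n - 2 \<and> b = n)"
| "bond (Type_E n) a b \<longleftrightarrow> (b = a + 1 \<and> 3 \<le> a) \<or> (a = 1 \<and> b = 3) \<or> (a = 2 \<and> b = 4)"
| "bond _ a b \<longleftrightarrow> b = a + 1"

text \<open>Square lengths of the simple roots, long roots having square length 2.\<close>

fun sq_length :: "lie_type \<Rightarrow> nat \<Rightarrow> rat" where
  "sq_length (Type_B n) a = (if a = n then 1 else 2)"
| "sq_length (Type_C n) a = (if a = n then 2 else 1)"
| "sq_length Type_F4 a = (if a \<le> 2 then 2 else 1)"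
| "sq_length Type_G2 a = (if a = 1 then 2 else 2 / 3)"
| "sq_length _ a = 2"

text \<open>
  The form on simple roots.  If two nodes are joined, the Cartan integer with respect to the
  longer (or equally long) of the two roots is -1, so their product is minus half the larger
  square length.
\<close>

definition form :: "lie_type \<Rightarrow> nat \<Rightarrow> nat \<Rightarrow> rat" where
  "form X a b =
     (if a = b then sq_length X a
      else if bond X a b \<or> bond X b a then - max (sq_length X a) (sq_length X b) / 2
      else 0)"

definition t :: "lie_type \<Rightarrow> nat \<Rightarrow> rat" where
  "t X a = 2 / form X a a"

definition cartan :: "lie_type \<Rightarrow> nat \<Rightarrow> nat \<Rightarrow> rat" where
  "cartan X a b = t X a * form X a b"

definition adjacent :: "lie_type \<Rightarrow> nat \<Rightarrow> nat \<Rightarrow> bool" where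
  "adjacent X a b \<longleftrightarrow> a \<in> nodes X \<and> b \<in> nodes X \<and> cartan X a b < 0"

text \<open>
  A weight is given by its coefficients in the basis of fundamental weights;
  \<open>simple_root X a b\<close> and \<open>fund_weight a b\<close> are the \<open>b\<close>-th coefficients.
\<close>

definition simple_root :: "lie_type \<Rightarrow> nat \<Rightarrow> nat \<Rightarrow> rat" where
  "simple_root X a b = cartan X b a"

definition fund_weight :: "nat \<Rightarrow> nat \<Rightarrow> rat" where
  "fund_weight a b = (if a = b then 1 else 0)"

definition weights :: "lie_type \<Rightarrow> (nat \<Rightarrow> int) set" where
  "weights X = {lam. \<forall>b. b \<notin> nodes X \<longrightarrow> lam b = 0}"

definition dominant_weights :: "lie_type \<Rightarrow> (nat \<Rightarrow> int) set" where
  "dominant_weights X = {lam \<in> weights X. \<forall>b \<in> nodes X. lam b \<ge> 0}"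

text \<open>
  The product form is used, since the expression through infinite products is \<open>0 / 0\<close>
  when \<open>p + m < 0\<close>.
\<close>

definition qbinom_curly :: "int \<Rightarrow> nat \<Rightarrow> 'a::field \<Rightarrow> 'a" where
  "qbinom_curly p m q = (\<Prod>i = 1..m. (1 - q powi (p + int i)) / (1 - q ^ i))"

definition qbinom_square :: "int \<Rightarrow> nat \<Rightarrow> 'a::field \<Rightarrow> 'a" where
  "qbinom_square p m q = (if p \<ge> 0 then qbinom_curly p m q else 0)"

text \<open>
  Both the data \<open>\<nu>\<close> of a tensor product \<open>W\<close> and a summation variable \<open>m\<close> are finitely supported
  families of natural numbers indexed by pairs (node, positive integer).  They are represented
  by multisets of such pairs, \<open>count W (a, j)\<close> being the exponent of the factor with indices
  \<open>a\<close> and \<open>j\<close>, so that tensor product is addition of multisets and a sum weighted by the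
  multiplicities is a multiset sum.
\<close>

type_synonym family = "(nat \<times> nat) multiset"

definition all_indices :: "lie_type \<Rightarrow> (nat \<times> nat) set" where
  "all_indices X = {(a, j). a \<in> nodes X \<and> 1 \<le> j}"

definition level_indices :: "lie_type \<Rightarrow> nat \<Rightarrow> (nat \<times> nat) set" where
  "level_indices X l = {(a, j). a \<in> nodes X \<and> 1 \<le> j \<and> of_nat j \<le> t X a * of_nat l}"

definition vacancy :: "lie_type \<Rightarrow> family \<Rightarrow> family \<Rightarrow> nat \<Rightarrow> nat \<Rightarrow> rat" where
  "vacancy X W m a i =
     (\<Sum>(b, j) \<in># W. if b = a then of_nat (min i j) else 0)
     - (\<Sum>(b, k) \<in># m. form X a b * min (t X b * of_nat i) (t X a * of_nat k))"

definition charge :: "lie_type \<Rightarrow> family \<Rightarrow> family \<Rightarrow> rat" where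
  "charge X W m =
     1 / 2 * (\<Sum>(a, j) \<in># m. \<Sum>(b, k) \<in># m.
                form X a b * min (t X b * of_nat j) (t X a * of_nat k))
     - (\<Sum>(a, j) \<in># W. \<Sum>(b, k) \<in># m. if b = a then of_nat (min j k) else 0)"

text \<open>
  Families supported in the index set \<open>I\<close> satisfying the weight condition.  There are finitely
  many of them: the Cartan matrix is invertible, so \<open>\<Sum>i. i * m a i\<close> is fixed for every \<open>a\<close>.
\<close>

definition configurations ::
    "lie_type \<Rightarrow> (nat \<times> nat) set \<Rightarrow> family \<Rightarrow> (nat \<Rightarrow> int) \<Rightarrow> family set" where
  "configurations X I W lam =
     {m. set_mset m \<subseteq> I \<and>
         (\<forall>b \<in> nodes X.
            (\<Sum>(a, i) \<in># m. of_nat i * simple_root X a b)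
            = (\<Sum>(a, i) \<in># W. of_nat i * fund_weight a b) - of_int (lam b))}"

text \<open>
  Vacancy numbers and charges are integers (see \<open>vacancy_integer\<close> and \<open>charge_integer\<close>); the
  floor functions below only convert their type.  In \<open>M\<close> the product may be restricted to the
  support of \<open>m\<close>, as \<open>qbinom_square p 0 q = 1\<close> for \<open>p \<ge> 0\<close>.  The sums in \<open>M_level\<close> and
  \<open>N_level\<close> are meant for \<open>W\<close> supported in \<open>level_indices X l\<close>; then restricting the sums in
  \<open>charge\<close> and \<open>vacancy\<close> to these indices is automatic.
\<close>

definition M :: "lie_type \<Rightarrow> family \<Rightarrow> (nat \<Rightarrow> int) \<Rightarrow> 'a::field \<Rightarrow> 'a" where
  "M X W lam q =
     (\<Sum>m | m \<in> configurations X (all_indices X) W lam \<and>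
            (\<forall>(a, i) \<in> all_indices X. 0 \<le> vacancy X W m a i).
        q powi \<lfloor>charge X W m\<rfloor> *
        (\<Prod>(a, i) \<in> set_mset m. qbinom_square \<lfloor>vacancy X W m a i\<rfloor> (count m (a, i)) q))"

definition M_level :: "lie_type \<Rightarrow> nat \<Rightarrow> family \<Rightarrow> 'a::field \<Rightarrow> 'a" where
  "M_level X l W q =
     (\<Sum>m | m \<in> configurations X (level_indices X l) W (\<lambda>_. 0) \<and>
            (\<forall>(a, i) \<in> level_indices X l. 0 \<le> vacancy X W m a i).
        q powi \<lfloor>charge X W m\<rfloor> *
        (\<Prod>(a, i) \<in> level_indices X l.
            qbinom_square \<lfloor>vacancy X W m a i\<rfloor> (count m (a, i)) q))"

definition N_level :: "lie_type \<Rightarrow> nat \<Rightarrow> family \<Rightarrow> (nat \<Rightarrow> int) \<Rightarrow> 'a::field \<Rightarrow> 'a" where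
  "N_level X l W lam q =
     (\<Sum>m \<in> configurations X (level_indices X l) W lam.
        q powi \<lfloor>charge X W m\<rfloor> *
        (\<Prod>(a, i) \<in> level_indices X l.
            qbinom_curly \<lfloor>vacancy X W m a i\<rfloor> (count m (a, i)) q))"

text \<open>A single tensor factor; factors with lower index 0 are trivial and omitted.\<close>

definition factor :: "nat \<Rightarrow> nat \<Rightarrow> family" where
  "factor a j = (if j = 0 then {#} else {#(a, j)#})"

definition W1 :: "nat \<Rightarrow> nat \<Rightarrow> family \<Rightarrow> family" where
  "W1 a0 j0 W = factor a0 j0 + factor a0 j0 + W"

definition W2 :: "nat \<Rightarrow> nat \<Rightarrow> family \<Rightarrow> family" where
  "W2 a0 j0 W = factor a0 (j0 + 1) + factor a0 (j0 - 1) + W"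

definition W3 :: "lie_type \<Rightarrow> nat \<Rightarrow> nat \<Rightarrow> family \<Rightarrow> family" where
  "W3 X a0 j0 W =
     (\<Sum>b | adjacent X a0 b. \<Sum>k | of_nat k \<le> - cartan X a0 b - 1.
        factor b (nat \<lfloor>(cartan X b a0 * of_nat j0 - of_nat k) / cartan X a0 b\<rfloor>)) + W"

definition theta :: "nat \<Rightarrow> nat \<Rightarrow> family \<Rightarrow> nat" where
  "theta a0 j0 W = j0 + (\<Sum>(b, k) \<in># W. if b = a0 then min j0 k else 0)"

lemma sq_length_cases: "sq_length X a \<in> {2, 1, 2 / 3}"
  by (cases X) auto

lemma form_commute: "form X a b = form X b a"
  by (auto simp: form_def max.commute)

lemma cartan_integer: "cartan X a b \<in> \<int>"
proof -
  have *: "sq_length X a = 2 \<or> sq_length X a = 1 \<or> sq_length X a = 2 / 3"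
          "sq_length X b = 2 \<or> sq_length X b = 1 \<or> sq_length X b = 2 / 3"
          "sq_length X a = 2 / 3 \<longrightarrow> sq_length X b \<noteq> 1"
          "sq_length X b = 2 / 3 \<longrightarrow> sq_length X a \<noteq> 1"
    by (cases X; simp)+
  have "2 / s * (- max s u / 2) \<in> {-1, -2, -3}"
    if "s = 2 \<or> s = 1 \<or> s = 2 / 3" "u = 2 \<or> u = 1 \<or> u = 2 / 3"
      "s = 2 / 3 \<longrightarrow> u \<noteq> 1" "u = 2 / 3 \<longrightarrow> s \<noteq> 1" for s u :: rat
    using that by (elim disjE; hypsubst) (simp_all add: max_def)
  from this[OF *] *(1) have "cartan X a b \<in> {2, 0, -1, -2, -3}"
    by (auto simp: cartan_def t_def form_def)
  then show ?thesis by auto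
qed

lemma pair_integer: "form X a b * min (t X b * of_nat j) (t X a * of_nat k) \<in> \<int>"
proof -
  have 1: "form X a b * (t X b * of_nat j) = cartan X b a * of_nat j"
    by (simp add: cartan_def form_commute[of X a b])
  have 2: "form X a b * (t X a * of_nat k) = cartan X a b * of_nat k"
    by (simp add: cartan_def)
  show ?thesis
    unfolding min_def by (simp only: 1 2 split: if_split) (simp add: cartan_integer)
qed

lemma sum_mset_integer: "(\<And>x. f x \<in> \<int>) \<Longrightarrow> (\<Sum>x \<in># A. f x) \<in> (\<int> :: rat set)"
  by (induction A) auto

lemma vacancy_integer: "vacancy X W m a i \<in> \<int>"
  unfolding vacancy_def
  by (intro Ints_diff sum_mset_integer) (auto simp: pair_integer split: prod.split)

lemma half_square_integer:
  fixes g :: "'b \<Rightarrow> 'b \<Rightarrow> rat"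
  assumes "\<And>x y. g x y \<in> \<int>" "\<And>x y. g x y = g y x" "\<And>x. g x x / 2 \<in> \<int>"
  shows "1 / 2 * (\<Sum>x \<in># A. \<Sum>y \<in># A. g x y) \<in> \<int>"
proof (induction A)
  case (add z A)
  have "(\<Sum>x \<in># A. g x z) = (\<Sum>x \<in># A. g z x)"
    by (simp only: assms(2)[of _ z])
  then have eq: "1 / 2 * (\<Sum>x \<in># add_mset z A. \<Sum>y \<in># add_mset z A. g x y)
        = g z z / 2 + (\<Sum>y \<in># A. g z y) + 1 / 2 * (\<Sum>x \<in># A. \<Sum>y \<in># A. g x y)"
    by (simp add: sum_mset.distrib algebra_simps)
  show ?case
    unfolding eq by (intro Ints_add assms(3) sum_mset_integer assms(1) add.IH)
qed simp

lemma charge_integer: "charge X W m \<in> \<int>"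
proof -
  define g where "g = (\<lambda>(a, j) (b, k). form X a b * min (t X b * of_nat j) (t X a * of_nat k))"
  have t: "form X a a * t X a = 2" "t X a > 0" for a
    using sq_length_cases[of X a] by (auto simp: t_def form_def)
  have g1: "g x y \<in> \<int>" for x y
    by (auto simp: g_def pair_integer split: prod.split)
  have g2: "g x y = g y x" for x y
    by (auto simp: g_def form_commute min.commute split: prod.split)
  have g3: "g x x / 2 \<in> \<int>" for x
    using t by (auto simp: g_def mult.assoc[symmetric] split: prod.split)
  have "1 / 2 * (\<Sum>x \<in># m. \<Sum>y \<in># m. g x y) \<in> \<int>"
    using g1 g2 g3 by (rule half_square_integer)
  moreover have "(\<Sum>(a, j) \<in># W. \<Sum>(b, k) \<in># m. if b = a then of_nat (min j k) else 0)
                 \<in> (\<int> :: rat set)"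
    by (auto intro!: sum_mset_integer split: prod.split)
  moreover have "(\<Sum>x \<in># m. \<Sum>y \<in># m. g x y) =
      (\<Sum>(a, j) \<in># m. \<Sum>(b, k) \<in># m.
         form X a b * min (t X b * of_nat j) (t X a * of_nat k))"
    by (simp add: g_def split_def)
  ultimately show ?thesis
    unfolding charge_def by (simp only: Ints_diff)
qed

end

theory Submission
  imports Defs
begin

text \<open>
  For a configuration \<open>m\<close> let \<open>p\<close> be the vacancy number of \<open>W1\<close> at \<open>(a0, j0)\<close> and \<open>k\<close> the
  multiplicity of \<open>(a0, j0)\<close> in \<open>m\<close>.  Passing from \<open>W1\<close> to \<open>W2\<close> lowers \<open>p\<close> by 1, raises the
  charge by \<open>k\<close>, and changes no other vacancy number.  Removing one copy of \<open>(a0, j0)\<close> from \<open>m\<close>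
  and passing from \<open>W1\<close> to \<open>W3\<close> changes no vacancy number and raises the charge by \<open>theta\<close>;
  this rests on Hermite's identity for the sum of the floors of \<open>(x + k) / c\<close> over \<open>k < c\<close>.  So
  the relation for \<open>N\<close> holds summand by summand, as the q-Pascal rule at \<open>(a0, j0)\<close>.  For \<open>M\<close>
  the sign conditions for \<open>W1\<close> and \<open>W2\<close> differ only when \<open>p = 0\<close>; then \<open>k > 0\<close> by concavity of
  the vacancy numbers, so the summand of \<open>W2\<close> vanishes anyway.
\<close>

subsection \<open>The form on the root lattice\<close>

lemma t_pos: "t X a > 0"
  using sq_length_cases[of X a] by (auto simp: t_def form_def)

lemma t_form_self: "t X a * form X a a = 2"
  using sq_length_cases[of X a] by (auto simp: t_def form_def)

lemma form_nonpos: "a \<noteq> b \<Longrightarrow> form X a b \<le> 0"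
  using sq_length_cases[of X a] sq_length_cases[of X b] by (auto simp: form_def)

lemma adjacent_iff_form:
  "a \<in> nodes X \<Longrightarrow> b \<in> nodes X \<Longrightarrow> adjacent X a b \<longleftrightarrow> form X a b < 0"
  by (simp add: adjacent_def cartan_def mult_less_0_iff t_pos not_less_iff_gr_or_eq less_not_sym)

subsection \<open>Finiteness of the set of configurations\<close>

text \<open>In types A, B and C the labelled diagram is a path, so only the nodes
  \<open>a - 1\<close>, \<open>a\<close> and \<open>a + 1\<close> contribute to a pairing with the
  simple root of \<open>a\<close>.\<close>

lemma sum_tridiagonal:
  fixes f :: "nat \<Rightarrow> rat"
  assumes "1 \<le> a" "a \<le> n" "\<And>b. 1 \<le> b \<Longrightarrow> b \<le> n \<Longrightarrow> b \<noteq> a \<Longrightarrow> b \<noteq> a + 1 \<Longrightarrow> a \<noteq> b + 1 \<Longrightarrow> f b = 0"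
  shows "sum f {1..n} = (if 2 \<le> a then f (a - 1) else 0) + f a + (if a < n then f (a + 1) else 0)"
proof -
  have "sum f {1..n} = sum f ({1..n} \<inter> {a - 1, a, a + 1})"
    using assms(1,2) by (intro sum.mono_neutral_right) (auto intro!: assms(3))
  also have "{1..n} \<inter> {a - 1, a, a + 1}
      = (if 2 \<le> a then {a - 1} else {}) \<union> {a} \<union> (if a < n then {a + 1} else {})"
    using assms(1,2) by auto
  also have "sum f \<dots> = (if 2 \<le> a then f (a - 1) else 0) + f a + (if a < n then f (a + 1) else 0)"
    using assms(1,2) by (auto simp: sum.insert_if)
  finally show ?thesis .
qed

text \<open>
  The vectors \<open>w\<close> are modelled on the sum of the positive roots.  Their only role is to bound a
  configuration by its weight, so that all sums are over finite sets.
\<close>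

lemma pos_pairing_A: "\<exists>w. \<forall>a \<in> nodes (Type_A n). 0 < (\<Sum>b \<in> nodes (Type_A n). w b * form (Type_A n) b a)"
proof (intro exI ballI)
  \<comment> \<open>These are the coefficients of the sum of the positive roots, which pairs with
    each simple root to its square length.\<close>
  define w :: "nat \<Rightarrow> rat" where "w = (\<lambda>b. of_nat b * (of_nat n + 1 - of_nat b))"
  fix a assume a: "a \<in> nodes (Type_A n)"
  have "(\<Sum>b \<in> nodes (Type_A n). w b * form (Type_A n) b a)
     = (if 2 \<le> a then w (a-1) * form (Type_A n) (a-1) a else 0) + w a * form (Type_A n) a a
       + (if a < n then w (a+1) * form (Type_A n) (a+1) a else 0)"
    unfolding nodes_def rank.simps
    by (intro sum_tridiagonal) (use a in \<open>auto simp: nodes_def form_def\<close>)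
  also have "\<dots> = 2"
    using a by (cases "2 \<le> a"; cases "a < n")
      (auto simp: nodes_def form_def w_def of_nat_diff algebra_simps not_less_eq_eq dest!: le_antisym)
  finally show "0 < (\<Sum>b \<in> nodes (Type_A n). w b * form (Type_A n) b a)" by simp
qed

lemma pos_pairing_B: "\<exists>w. \<forall>a \<in> nodes (Type_B n). 0 < (\<Sum>b \<in> nodes (Type_B n). w b * form (Type_B n) b a)"
proof (intro exI ballI)
  define w :: "nat \<Rightarrow> rat" where "w = (\<lambda>b. of_nat b * (2 * of_nat n - of_nat b))"
  fix a assume a: "a \<in> nodes (Type_B n)"
  have "(\<Sum>b \<in> nodes (Type_B n). w b * form (Type_B n) b a)
     = (if 2 \<le> a then w (a-1) * form (Type_B n) (a-1) a else 0) + w a * form (Type_B n) a a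
       + (if a < n then w (a+1) * form (Type_B n) (a+1) a else 0)"
    unfolding nodes_def rank.simps
    by (intro sum_tridiagonal) (use a in \<open>auto simp: nodes_def form_def\<close>)
  also have "\<dots> = (if a = n then 1 else 2)"
    using a by (cases "2 \<le> a"; cases "a < n")
      (auto simp: nodes_def form_def w_def of_nat_diff algebra_simps not_less_eq_eq dest!: le_antisym)
  finally show "0 < (\<Sum>b \<in> nodes (Type_B n). w b * form (Type_B n) b a)" by (simp split: if_splits)
qed

lemma pos_pairing_C:
  assumes "n \<ge> 2"
  shows "\<exists>w. \<forall>a \<in> nodes (Type_C n). 0 < (\<Sum>b \<in> nodes (Type_C n). w b * form (Type_C n) b a)"
proof (intro exI ballI)
  \<comment> \<open>Here half the sum of the positive coroots is taken; it pairs to 1 with every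
    simple root.\<close>
  define w :: "nat \<Rightarrow> rat" where
    "w = (\<lambda>b. of_nat b * (2 * of_nat n - of_nat b) / (if b = n then 2 else 1))"
  fix a assume a: "a \<in> nodes (Type_C n)"
  have "(\<Sum>b \<in> nodes (Type_C n). w b * form (Type_C n) b a)
     = (if 2 \<le> a then w (a-1) * form (Type_C n) (a-1) a else 0) + w a * form (Type_C n) a a
       + (if a < n then w (a+1) * form (Type_C n) (a+1) a else 0)"
    unfolding nodes_def rank.simps
    by (intro sum_tridiagonal) (use a in \<open>auto simp: nodes_def form_def\<close>)
  also have "\<dots> = 1"
    using a assms by (cases "2 \<le> a"; cases "a < n"; cases "a + 1 = n")
      (auto simp: nodes_def form_def w_def of_nat_diff field_simps not_less_eq_eq dest!: le_antisym)
  finally show "0 < (\<Sum>b \<in> nodes (Type_C n). w b * form (Type_C n) b a)" by simp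
qed

lemma pos_pairing_D:
  assumes "n \<ge> 4"
  shows "\<exists>w. \<forall>a \<in> nodes (Type_D n). 0 < (\<Sum>b \<in> nodes (Type_D n). w b * form (Type_D n) b a)"
proof (intro exI ballI)
  define r where "r = n - 2"
  then have n: "n = r + 2" and r: "r \<ge> 2"
    using assms by simp_all
  \<comment> \<open>Type B coefficients along the chain; the value at the nodes \<open>n - 1\<close>
    and \<open>n\<close> makes the pairings there 3, and all others are 2.\<close>
  define w :: "nat \<Rightarrow> rat" where
    "w = (\<lambda>b. if r < b then (of_nat n ^ 2 - 1) / 2 else of_nat b * (2 * of_nat n - of_nat b))"
  let ?f = "\<lambda>a b. w b * form (Type_D n) b a"
  fix a assume a: "a \<in> nodes (Type_D n)"
  have mono: "sum (?f a) (nodes (Type_D n)) = sum (?f a) S"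
    if "S \<subseteq> nodes (Type_D n)" "\<forall>b \<in> nodes (Type_D n) - S. form (Type_D n) b a = 0" for S
    using that by (intro sum.mono_neutral_right) (auto simp: nodes_def)
  consider "a = r + 2" | "a = r + 1" | "a = r" | "a < r" "a = 1" | "a < r" "2 \<le> a"
    using a by (auto simp: nodes_def n) linarith+
  then show "0 < sum (?f a) (nodes (Type_D n))"
  proof cases
    case 1
    show ?thesis
      by (subst mono[of "{r, r + 2}"])
        (use 1 r in \<open>auto simp: nodes_def form_def n w_def power2_eq_square algebra_simps\<close>)
  next
    case 2
    show ?thesis
      by (subst mono[of "{r, r + 1}"])
        (use 2 r in \<open>auto simp: nodes_def form_def n w_def power2_eq_square algebra_simps\<close>)
  next
    case 3
    then obtain c where c: "a = c + 1" "r = c + 1" "c \<ge> 1"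
      using r that[of "r - 1"] by auto
    show ?thesis
      by (subst mono[of "{c, c + 1, c + 2, c + 3}"])
        (use c in \<open>auto simp: nodes_def form_def n w_def power2_eq_square algebra_simps\<close>)
  next
    case 4
    show ?thesis
      by (subst mono[of "{1, 2}"])
        (use 4 r in \<open>auto simp: nodes_def form_def n w_def power2_eq_square algebra_simps\<close>)
  next
    case 5
    then obtain c where c: "a = c + 1" "c + 1 < r" "c \<ge> 1"
      using that[of "a - 1"] by auto
    show ?thesis
      by (subst mono[of "{c, c + 1, c + 2}"])
        (use c in \<open>auto simp: nodes_def form_def n w_def power2_eq_square algebra_simps\<close>)
  qed
qed

lemma atLeastAtMost_small:
  "{1..8} = {1, 2, 3, 4, 5, 6, 7, 8 :: nat}" "{1..7} = {1, 2, 3, 4, 5, 6, 7 :: nat}"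
  "{1..6} = {1, 2, 3, 4, 5, 6 :: nat}" "{1..4} = {1, 2, 3, 4 :: nat}" "{1..2} = {1, 2 :: nat}"
  by auto

lemma pos_pairing_E:
  assumes "n \<in> {6, 7, 8}"
  shows "\<exists>w. \<forall>a \<in> nodes (Type_E n). 0 < (\<Sum>b \<in> nodes (Type_E n). w b * form (Type_E n) b a)"
  using assms
  \<comment> \<open>The sum of the positive roots for \<open>n = 8\<close>, with a dummy entry at
    index 0. It also serves for \<open>n = 6\<close> and \<open>n = 7\<close>: the omitted terms are
    nonpositive, so dropping them cannot lower a pairing.\<close>
  by (intro exI[of _ "\<lambda>b. [0, 92, 136, 182, 270, 220, 168, 114, 58] ! b"], elim insertE emptyE; hypsubst)
    (simp_all add: nodes_def atLeastAtMost_small form_def del: One_nat_def)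

lemma pos_pairing_F: "\<exists>w. \<forall>a \<in> nodes Type_F4. 0 < (\<Sum>b \<in> nodes Type_F4. w b * form Type_F4 b a)"
  by (rule exI[of _ "\<lambda>b. [0, 16, 30, 42, 22] ! b"])
   (simp add: nodes_def atLeastAtMost_small form_def del: One_nat_def)

lemma pos_pairing_G: "\<exists>w. \<forall>a \<in> nodes Type_G2. 0 < (\<Sum>b \<in> nodes Type_G2. w b * form Type_G2 b a)"
  by (rule exI[of _ "\<lambda>b. [0, 6, 10] ! b"])
   (simp add: nodes_def atLeastAtMost_small form_def del: One_nat_def)

lemma exists_pos_pairing:
  assumes "valid_type X"
  shows "\<exists>w. \<forall>a \<in> nodes X. 0 < (\<Sum>b \<in> nodes X. w b * form X b a)"
  using assms pos_pairing_A pos_pairing_B pos_pairing_C pos_pairing_D pos_pairing_E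
    pos_pairing_F pos_pairing_G
  by (cases X) (simp_all only: valid_type.simps)

lemma sum_mset_sum_swap:
  "(\<Sum>x \<in># A. \<Sum>b \<in> B. f b x) = (\<Sum>b \<in> B. \<Sum>x \<in># A. f b x)"
  by (induction A) (simp_all add: sum.distrib)

text \<open>Second indices are at least 1, so a bound on their sum bounds both the size of
  \<open>m\<close> and each second index.\<close>

lemma finite_bounded_nat_weight:
  fixes I :: "(nat \<times> nat) set"
  assumes "finite B" "I \<subseteq> B \<times> {1..}"
  shows "finite {m. set_mset m \<subseteq> I \<and> (\<Sum>(a, i) \<in># m. i) \<le> N}"
proof (rule finite_subset)
  show "{m. set_mset m \<subseteq> I \<and> (\<Sum>(a, i) \<in># m. i) \<le> N}
      \<subseteq> (\<Union>k \<le> N. multisets_of_size (B \<times> {..N}) k)"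
  proof
    fix m assume "m \<in> {m. set_mset m \<subseteq> I \<and> (\<Sum>(a, i) \<in># m. i) \<le> N}"
    then have m: "set_mset m \<subseteq> I" "(\<Sum>(a, i) \<in># m. i) \<le> N" by auto
    have "size m \<le> (\<Sum>(a, i) \<in># m. i)"
      using m(1) assms(2) by (induction m) auto
    moreover have "i \<le> (\<Sum>(a, i) \<in># m. i)" if "(a, i) \<in># m" for a i
      using that by (auto dest!: multi_member_split)
    ultimately show "m \<in> (\<Union>k \<le> N. multisets_of_size (B \<times> {..N}) k)"
      using m assms(2) by (fastforce simp: multisets_of_size_def)
  qed
  show "finite (\<Union>k \<le> N. multisets_of_size (B \<times> {..N}) k)"
    using assms(1) by auto
qed

text \<open>Pairing the weight condition with \<open>w\<close> fixes the sum of
  \<open>i * d a\<close> over \<open>m\<close>. Every \<open>d a\<close> is at least \<delta> > 0,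
  so the sum of the second indices is bounded.\<close>

lemma finite_configurations:
  assumes "valid_type X" "I \<subseteq> all_indices X"
  shows "finite (configurations X I W lam)"
proof -
  obtain w where w: "\<And>a. a \<in> nodes X \<Longrightarrow> 0 < (\<Sum>b \<in> nodes X. w b * form X b a)"
    using exists_pos_pairing[OF assms(1)] by auto
  define d where "d = (\<lambda>a. \<Sum>b \<in> nodes X. w b * form X b a)"
  have "1 \<in> nodes X"
    using assms(1) by (cases X) (auto simp: nodes_def)
  then have ne: "nodes X \<noteq> {}" by auto
  have fin: "finite (nodes X)" by (simp add: nodes_def)
  define \<delta> where "\<delta> = Min (d ` nodes X)"
  have \<delta>: "\<delta> > 0" "\<And>a. a \<in> nodes X \<Longrightarrow> \<delta> \<le> d a"
    using ne fin w by (auto simp: \<delta>_def d_def)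
  define y where "y = (\<lambda>b. (\<Sum>(a, i) \<in># W. of_nat i * fund_weight a b) - of_int (lam b))"
  \<comment> \<open>Since \<open>simple_root X a b\<close> is \<open>t X b * form X b a\<close>,
    dividing by \<open>t X b\<close> recovers the form.\<close>
  define K where "K = (\<Sum>b \<in> nodes X. w b / t X b * y b)"
  define N where "N = nat \<lceil>K / \<delta>\<rceil>"
  have "(\<Sum>(a, i) \<in># m. i) \<le> N" if m: "m \<in> configurations X I W lam" for m
  proof -
    have sub: "set_mset m \<subseteq> all_indices X" using m assms(2) by (auto simp: configurations_def)
    have "(\<Sum>(a, i) \<in># m. of_nat i * d a)
        = (\<Sum>x \<in># m. \<Sum>b \<in> nodes X. w b / t X b * (of_nat (snd x) * simple_root X (fst x) b))"
      by (intro arg_cong[where f = sum_mset] image_mset_cong)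
        (auto simp: d_def simple_root_def cartan_def sum_distrib_left t_pos[THEN less_imp_neq, symmetric]
          intro!: sum.cong)
    also have "\<dots> = (\<Sum>b \<in> nodes X. w b / t X b * (\<Sum>(a, i) \<in># m. of_nat i * simple_root X a b))"
      by (simp add: sum_mset_sum_swap sum_mset_distrib_left split_def)
    also have "\<dots> = K"
      using m by (auto simp: K_def y_def configurations_def intro!: sum.cong)
    finally have "(\<Sum>(a, i) \<in># m. of_nat i * d a) = K" .
    moreover have "\<delta> * of_nat (\<Sum>(a, i) \<in># m. i) \<le> (\<Sum>(a, i) \<in># m. of_nat i * d a)"
      using sub
    proof (induction m)
      case (add x m)
      obtain a i where x: "x = (a, i)" by force
      then have "\<delta> * of_nat i \<le> of_nat i * d a"
        using add.prems \<delta>(2)[of a] by (simp add: mult.commute all_indices_def mult_right_mono)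
      then show ?case using add x by (simp add: ring_distribs)
    qed simp
    ultimately have "of_nat (\<Sum>(a, i) \<in># m. i) \<le> K / \<delta>"
      using \<delta>(1) by (simp add: field_simps)
    then show ?thesis unfolding N_def by linarith
  qed
  moreover have "set_mset m \<subseteq> I" if "m \<in> configurations X I W lam" for m
    using that by (simp add: configurations_def)
  ultimately have "configurations X I W lam \<subseteq> {m. set_mset m \<subseteq> I \<and> (\<Sum>(a, i) \<in># m. i) \<le> N}"
    by blast
  then show ?thesis
    by (rule finite_subset)
      (use fin assms(2) in \<open>auto intro!: finite_bounded_nat_weight[of "nodes X"] simp: all_indices_def\<close>)
qed

subsection \<open>The q-Pascal rule and Hermite's identity\<close>

text \<open>Hermite's identity. When \<open>x\<close> grows by one, the window of \<open>c\<close>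
  consecutive numerators loses \<open>x div c\<close> and gains \<open>(x + c) div c\<close>, which
  is one more.\<close>

lemma sum_div_shift: "(\<Sum>k<c. (x + k) div c) = x" if "c > 0" for c x :: nat
proof (induction x)
  case 0
  then show ?case by simp
next
  case (Suc x)
  have "(\<Sum>k<Suc c. (x + k) div c) = x div c + (\<Sum>k<c. (Suc x + k) div c)"
    by (subst sum.lessThan_Suc_shift) simp
  moreover have "(\<Sum>k<Suc c. (x + k) div c) = x + (x div c + 1)"
    using Suc that by simp
  ultimately show ?case by simp
qed

text \<open>For \<open>k < c\<close> the cut at \<open>i\<close> moves inside the floor because
  \<open>(c * i + k) div c = i\<close>; then Hermite's identity applies to
  \<open>min (c * i) x\<close>.\<close>

lemma sum_min_div_shift: "(\<Sum>k<c. min i ((x + k) div c)) = min (c * i) x"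
  if "c > 0" for c i x :: nat
proof -
  have "min i ((x + k) div c) = (min (c * i) x + k) div c" if "k < c" for k
  proof (cases "c * i \<le> x")
    case True
    then have "i \<le> (x + k) div c"
      using \<open>c > 0\<close> by (simp add: less_eq_div_iff_mult_less_eq mult.commute)
    then show ?thesis using True that by (simp add: min_def)
  next
    case False
    then have "(x + k) div c \<le> (c * i + k) div c"
      by (intro div_le_mono) simp
    also have "\<dots> = i" using that by simp
    finally show ?thesis using False by (simp add: min_def)
  qed
  then show ?thesis
    using sum_div_shift[OF that, of "min (c * i) x"] by simp
qed

lemma qbinom_curly_0 [simp]: "qbinom_curly p 0 q = 1"
  by (simp add: qbinom_curly_def)

text \<open>The factor with \<open>i = 1\<close> has numerator 1 - q^0. This removes the summands of
  \<open>W2\<close> at which only its own sign condition fails.\<close>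

lemma qbinom_curly_minus_one: "m > 0 \<Longrightarrow> qbinom_curly (-1) m q = 0"
  by (auto simp: qbinom_curly_def intro!: prod_zero bexI[of _ 1])

lemma qbinom_curly_Suc:
  "qbinom_curly p (Suc m) q
    = qbinom_curly p m q * ((1 - q powi (p + int (Suc m))) / (1 - q ^ Suc m))"
  by (simp add: qbinom_curly_def)

text \<open>The exponents in the numerator on the left run from p to p + m, those of
  \<open>qbinom_curly p m q\<close> from p + 1 to p + m.\<close>

lemma qbinom_curly_Suc_shift:
  "q ^ Suc m \<noteq> 1 \<Longrightarrow> qbinom_curly (p - 1) (Suc m) q
    = qbinom_curly p m q * ((1 - q powi p) / (1 - q ^ Suc m))" for q :: "'a::field"
proof -
  have "(\<Prod>i=1..Suc m. 1 - q powi (p - 1 + int i)) = (1 - q powi p) * (\<Prod>i=1..m. 1 - q powi (p + int i))"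
    by (subst prod.atLeast_Suc_atMost, simp, simp only: prod.atLeast_Suc_atMost_Suc_shift)
      (simp add: o_def algebra_simps)
  then show ?thesis
    unfolding qbinom_curly_def prod_dividef by simp
qed

text \<open>After cancelling the common factor this is 1 - q^(p+m+1) = q^(m+1) (1 - q^p) + (1 -
  q^(m+1)), which holds for negative p as well.\<close>

lemma qbinom_curly_pascal:
  fixes q :: "'a::field"
  assumes "q \<noteq> 0" "q ^ Suc m \<noteq> 1"
  shows "qbinom_curly p (Suc m) q
    = q ^ Suc m * qbinom_curly (p - 1) (Suc m) q + qbinom_curly p m q"
proof -
  have "q powi (p + int (Suc m)) = q powi p * q ^ Suc m"
    using assms(1) by (simp only: power_int_add simp_thms disj_not1 power_int_of_nat not_False_eq_True)
  then have "(1 - q powi (p + int (Suc m))) / (1 - q ^ Suc m)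
      = q ^ Suc m * ((1 - q powi p) / (1 - q ^ Suc m)) + 1"
    using assms(2) by (simp add: field_simps del: power_Suc)
  then show ?thesis
    by (simp only: qbinom_curly_Suc_shift[OF assms(2)])
      (simp only: qbinom_curly_Suc ring_distribs mult_1_right mult.left_commute)
qed

subsection \<open>Vacancy numbers and charges\<close>

text \<open>The part of a vacancy number that depends on \<open>W\<close> alone; \<open>gram\<close>
  is the part that depends on \<open>m\<close> alone. The split lets changes of \<open>W\<close> and
  of \<open>m\<close> be followed separately.\<close>

definition pairing :: "family \<Rightarrow> nat \<Rightarrow> nat \<Rightarrow> rat" where
  "pairing W a i = (\<Sum>(b, j) \<in># W. if b = a then of_nat (min i j) else 0)"

definition kernel :: "lie_type \<Rightarrow> nat \<Rightarrow> nat \<Rightarrow> nat \<Rightarrow> nat \<Rightarrow> rat" where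
  "kernel X a i b k = form X a b * min (t X b * of_nat i) (t X a * of_nat k)"

definition gram :: "lie_type \<Rightarrow> family \<Rightarrow> nat \<Rightarrow> nat \<Rightarrow> rat" where
  "gram X m a i = (\<Sum>(b, k) \<in># m. kernel X a i b k)"

lemma kernel_commute: "kernel X a i b k = kernel X b k a i"
  by (simp add: kernel_def form_commute min.commute)

lemma kernel_self: "kernel X a i a k = 2 * of_nat (min i k)"
proof -
  have "min (t X a * of_nat i) (t X a * of_nat k) = t X a * of_nat (min i k)"
    using t_pos[of X a] by (simp add: min_def mult_le_cancel_left_pos)
  then show ?thesis
    using t_form_self[of X a] by (simp add: kernel_def mult.assoc[symmetric] mult.commute)
qed

lemma vacancy_eq: "vacancy X W m a i = pairing W a i - gram X m a i"
  by (simp add: vacancy_def pairing_def gram_def kernel_def)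

text \<open>In this form the charge is a quadratic function of \<open>m\<close> whose gradient is
  minus the vacancy number.\<close>

lemma charge_eq:
  "charge X W m = 1 / 2 * (\<Sum>(a, j) \<in># m. gram X m a j) - (\<Sum>(b, k) \<in># m. pairing W b k)"
proof -
  have pairing_sym: "pairing W b k = (\<Sum>(a, j) \<in># W. if b = a then of_nat (min j k) else 0)" for b k
    by (simp add: pairing_def split_def min.commute eq_commute[of b] cong: if_cong)
  have "(\<Sum>(a, j) \<in># W. \<Sum>(b, k) \<in># m. if b = a then of_nat (min j k) else 0)
      = (\<Sum>(b, k) \<in># m. pairing W b k)"
    unfolding pairing_sym split_def by (subst sum_mset.swap) (rule refl)
  then show ?thesis
    by (simp add: charge_def gram_def kernel_def)
qed

lemma pairing_W1: "1 \<le> j0 \<Longrightarrow> pairing (W1 a0 j0 W) b i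
    = pairing W b i + (if b = a0 then 2 * of_nat (min i j0) else 0)"
  by (simp add: pairing_def W1_def factor_def)

text \<open>The second difference of min(i, j) in j at \<open>j0\<close> is -1 for i =
  \<open>j0\<close> and 0 otherwise. For \<open>j0 = 1\<close> the omitted factor agrees with min(i,
  0) = 0.\<close>

lemma pairing_W2: "1 \<le> j0 \<Longrightarrow> pairing (W2 a0 j0 W) b i
    = pairing (W1 a0 j0 W) b i - (if (b, i) = (a0, j0) then 1 else 0)"
  by (auto simp: pairing_def W1_def W2_def factor_def of_nat_diff min_def not_le not_less_eq_eq le_Suc_eq)

lemma sum_mset_sum_add:
  "(\<Sum>x \<in># (\<Sum>y \<in> A. g y). f x) = (\<Sum>y \<in> A. \<Sum>x \<in># g y. f x)"
  by (induction A rule: infinite_finite_induct) simp_all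

text \<open>Natural-number values turn the floors in \<open>W3\<close> into \<open>div\<close>,
  where Hermite's identity is available.\<close>

definition neg_cartan :: "lie_type \<Rightarrow> nat \<Rightarrow> nat \<Rightarrow> nat" where
  "neg_cartan X a b = nat \<lfloor>- cartan X a b\<rfloor>"

lemma of_nat_neg_cartan: "a \<noteq> b \<Longrightarrow> of_nat (neg_cartan X a b) = - cartan X a b"
proof -
  assume "a \<noteq> b"
  then have "- cartan X a b \<ge> 0"
    using form_nonpos[of a b X] t_pos[of X a] by (simp add: cartan_def mult_le_0_iff)
  moreover obtain z where "cartan X a b = of_int z"
    using cartan_integer Ints_cases by blast
  ultimately show ?thesis by (simp add: neg_cartan_def)
qed

text \<open>\<open>\<phi>\<close> is later min(i, j) for the vacancy numbers and j for the weights.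
  The condition \<open>\<phi> 0 = 0\<close> accounts for the omitted trivial factors.\<close>

lemma sum_mset_W3:
  fixes \<phi> :: "nat \<Rightarrow> rat"
  assumes "a0 \<in> nodes X" "b \<in> nodes X" "\<phi> 0 = 0"
  defines "c \<equiv> neg_cartan X a0 b" and "d \<equiv> neg_cartan X b a0"
  shows "(\<Sum>(b', j) \<in># W3 X a0 j0 W. if b' = b then \<phi> j else 0)
    = (\<Sum>(b', j) \<in># W. if b' = b then \<phi> j else 0)
      + (if form X a0 b < 0 then \<Sum>k<c. \<phi> ((d * j0 + k) div c) else 0)"
proof -
  let ?f = "\<lambda>(b', j). if b' = b then \<phi> j else 0"
  let ?idx = "\<lambda>b' k. nat \<lfloor>(cartan X b' a0 * of_nat j0 - of_nat k) / cartan X a0 b'\<rfloor>"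
  have fin: "finite {b'. adjacent X a0 b'}"
    by (rule finite_subset[of _ "nodes X"]) (auto simp: adjacent_def nodes_def)
  have fac: "(\<Sum>x \<in># factor b' j. ?f x) = (if b' = b then \<phi> j else 0)" for b' j
    using assms(3) by (simp add: factor_def)
  have "(\<Sum>x \<in># W3 X a0 j0 W. ?f x) = (\<Sum>x \<in># W. ?f x)
     + (\<Sum>b' | adjacent X a0 b'. \<Sum>k | of_nat k \<le> - cartan X a0 b' - 1. if b' = b then \<phi> (?idx b' k) else 0)"
    by (simp add: W3_def sum_mset_sum_add fac)
  also have "(\<Sum>b' | adjacent X a0 b'. \<Sum>k | of_nat k \<le> - cartan X a0 b' - 1. if b' = b then \<phi> (?idx b' k) else 0)
     = (\<Sum>b' | adjacent X a0 b'. if b' = b then (\<Sum>k | of_nat k \<le> - cartan X a0 b - 1. \<phi> (?idx b k)) else 0)"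
    by (intro sum.cong) auto
  also have "\<dots> = (if form X a0 b < 0 then \<Sum>k | of_nat k \<le> - cartan X a0 b - 1. \<phi> (?idx b k) else 0)"
    using fin by (simp add: sum.delta' adjacent_iff_form[OF assms(1,2)])
  also have "\<dots> = (if form X a0 b < 0 then \<Sum>k<c. \<phi> ((d * j0 + k) div c) else 0)"
  proof (cases "form X a0 b < 0")
    case True
    then have "a0 \<noteq> b" using sq_length_cases[of X b] by (auto simp: form_def)
    then have c: "cartan X a0 b = - of_nat c" and d: "cartan X b a0 = - of_nat d"
      by (simp_all add: c_def d_def of_nat_neg_cartan)
    have "of_nat k \<le> of_nat c - (1 :: rat) \<longleftrightarrow> k < c" for k
      by linarith
    then have "{k. of_nat k \<le> - cartan X a0 b - 1} = {..<c}"
      by (auto simp: c)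
    \<comment> \<open>The signs of numerator and denominator cancel, leaving a quotient of natural
      numbers.\<close>
    moreover have "?idx b k = (d * j0 + k) div c" for k
    proof -
      have "(cartan X b a0 * of_nat j0 - of_nat k) / cartan X a0 b
          = of_nat (d * j0 + k) / of_nat c"
        by (cases "c = 0") (simp_all add: c d field_simps)
      then show ?thesis by (simp only: floor_divide_of_nat_eq nat_int)
    qed
    ultimately show ?thesis by simp
  qed simp
  finally show ?thesis .
qed

lemma neg_cartan_pos_iff: "a \<noteq> b \<Longrightarrow> 0 < neg_cartan X a b \<longleftrightarrow> form X a b < 0"
proof -
  assume "a \<noteq> b"
  then have "0 < neg_cartan X a b \<longleftrightarrow> (0 :: rat) < - cartan X a b"
    by (metis of_nat_neg_cartan of_nat_0_less_iff)
  then show ?thesis using t_pos[of X a] by (simp add: cartan_def mult_less_0_iff)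
qed

text \<open>At \<open>a0\<close> the kernel is twice a minimum and cancels the two extra factors of
  \<open>W1\<close>. At another node the form is nonpositive, so minus the kernel is
  \<open>min (c * i) (d * j0)\<close>, which the truncated Hermite identity produces from the
  factors of \<open>W3\<close>.\<close>

lemma pairing_W3:
  assumes "a0 \<in> nodes X" "b \<in> nodes X" "1 \<le> j0"
  shows "pairing (W3 X a0 j0 W) b i = pairing (W1 a0 j0 W) b i - kernel X b i a0 j0"
proof (cases "b = a0")
  case True
  then have "\<not> form X a0 b < 0" using sq_length_cases[of X b] by (auto simp: form_def)
  with True show ?thesis
    using assms by (simp add: pairing_def sum_mset_W3 pairing_W1[unfolded pairing_def] kernel_self)
next
  case False
  define c d where "c = neg_cartan X a0 b" and "d = neg_cartan X b a0"
  have cd: "form X b a0 * t X a0 = - of_nat c" "form X b a0 * t X b = - of_nat d"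
    using False by (simp_all add: c_def d_def of_nat_neg_cartan cartan_def form_commute mult.commute)
  have "- kernel X b i a0 j0 = - form X b a0 * min (t X a0 * of_nat i) (t X b * of_nat j0)"
    by (simp add: kernel_def)
  also have "\<dots> = min (- (form X b a0 * t X a0) * of_nat i) (- (form X b a0 * t X b) * of_nat j0)"
    using form_nonpos[OF False, of X] by (subst min_mult_distrib_left) (simp add: mult.assoc)
  also have "\<dots> = of_nat (min (c * i) (d * j0))"
    by (simp add: cd of_nat_min)
  also have "\<dots> = (if form X a0 b < 0 then \<Sum>k<c. of_nat (min i ((d * j0 + k) div c)) else 0)"
    using False neg_cartan_pos_iff[of a0 b X] 
    by (auto simp: c_def[symmetric] sum_min_div_shift simp flip: of_nat_sum)
  finally show ?thesis
    using False assms
    by (simp add: pairing_def sum_mset_W3[where \<phi> = "\<lambda>j. of_nat (min i j)"] pairing_W1[unfolded pairing_def]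
        c_def d_def)
qed

lemma gram_add: "gram X (add_mset (a0, j0) m) b i = gram X m b i + kernel X b i a0 j0"
  by (simp add: gram_def)

lemma vacancy_W3:
  assumes "a0 \<in> nodes X" "b \<in> nodes X" "1 \<le> j0"
  shows "vacancy X (W3 X a0 j0 W) m b i = vacancy X (W1 a0 j0 W) (add_mset (a0, j0) m) b i"
  by (simp add: vacancy_eq pairing_W3[OF assms] gram_add)

lemma vacancy_W2:
  "1 \<le> j0 \<Longrightarrow> vacancy X (W2 a0 j0 W) m b i
    = vacancy X (W1 a0 j0 W) m b i - (if (b, i) = (a0, j0) then 1 else 0)"
  by (simp only: vacancy_eq pairing_W2)

lemma charge_W2:
  assumes "1 \<le> j0"
  shows "charge X (W2 a0 j0 W) m = charge X (W1 a0 j0 W) m + of_nat (count m (a0, j0))"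
proof -
  have "(\<Sum>(b, k) \<in># m. pairing (W2 a0 j0 W) b k)
      = (\<Sum>(b, k) \<in># m. pairing (W1 a0 j0 W) b k) - of_nat (count m (a0, j0))"
    by (induction m) (auto simp: pairing_W2[OF assms] split: if_splits)
  then show ?thesis by (simp add: charge_eq)
qed

text \<open>In the quadratic expansion the cross terms cancel the difference of the pairings of
  \<open>W1\<close> and \<open>W3\<close>. What remains is half the self-kernel, \<open>j0\<close>,
  minus the pairing of \<open>W1\<close> at \<open>(a0, j0)\<close>, that is minus
  \<open>theta\<close>.\<close>

lemma charge_W3:
  assumes "a0 \<in> nodes X" "1 \<le> j0" "set_mset m \<subseteq> all_indices X"
  shows "charge X (W1 a0 j0 W) (add_mset (a0, j0) m)
    = charge X (W3 X a0 j0 W) m - of_nat (theta a0 j0 W)"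
proof -
  have th: "of_nat (theta a0 j0 W) = of_nat j0 + pairing W a0 j0"
    unfolding theta_def pairing_def of_nat_add of_nat_sum_mset
    by (auto intro!: arg_cong[where f = sum_mset] image_mset_cong simp: image_mset.compositionality o_def)
  have "(\<Sum>(b, k) \<in># m. pairing (W3 X a0 j0 W) b k)
      = (\<Sum>(b, k) \<in># m. pairing (W1 a0 j0 W) b k) - (\<Sum>(b, k) \<in># m. kernel X b k a0 j0)"
    using assms(3) by (induction m) (auto simp: pairing_W3[OF assms(1) _ assms(2)] all_indices_def)
  moreover have "gram X m a0 j0 = (\<Sum>(b, k) \<in># m. kernel X b k a0 j0)"
    by (simp add: gram_def kernel_commute[of X a0])
  moreover have "(\<Sum>(a, j) \<in># m. gram X (add_mset (a0, j0) m) a j)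
      = (\<Sum>(a, j) \<in># m. gram X m a j) + (\<Sum>(b, k) \<in># m. kernel X b k a0 j0)"
    by (simp add: gram_add split_def sum_mset.distrib)
  ultimately show ?thesis
    using assms(2) by (simp add: charge_eq th gram_add kernel_self pairing_W1 algebra_simps)
qed

subsection \<open>The recursion\<close>

text \<open>One summand serves all three sums: on nonnegative vacancy numbers both q-binomials
  agree, and places of multiplicity 0 contribute 1.\<close>

definition curly_term :: "lie_type \<Rightarrow> family \<Rightarrow> family \<Rightarrow> 'a::field \<Rightarrow> 'a" where
  "curly_term X W m q = q powi \<lfloor>charge X W m\<rfloor> *
     (\<Prod>(a, i) \<in> set_mset m. qbinom_curly \<lfloor>vacancy X W m a i\<rfloor> (count m (a, i)) q)"

lemma curly_term_superset:
  assumes "finite S" "set_mset m \<subseteq> S"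
  shows "curly_term X W m q = q powi \<lfloor>charge X W m\<rfloor> *
     (\<Prod>(a, i) \<in> S. qbinom_curly \<lfloor>vacancy X W m a i\<rfloor> (count m (a, i)) q)"
proof -
  have "(\<Prod>(a, i) \<in> set_mset m. qbinom_curly \<lfloor>vacancy X W m a i\<rfloor> (count m (a, i)) q)
      = (\<Prod>(a, i) \<in> S. qbinom_curly \<lfloor>vacancy X W m a i\<rfloor> (count m (a, i)) q)"
    using assms by (intro prod.mono_neutral_left) (auto simp: not_in_iff)
  then show ?thesis by (simp only: curly_term_def)
qed

lemma curly_term_pascal:
  fixes q :: "'a::field"
  assumes "a0 \<in> nodes X" "1 \<le> j0" "set_mset m \<subseteq> all_indices X"
    and q: "q \<noteq> 0" "\<And>i. 1 \<le> i \<Longrightarrow> q ^ i \<noteq> 1"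
  shows "curly_term X (W1 a0 j0 W) m q = curly_term X (W2 a0 j0 W) m q
    + (if (a0, j0) \<in># m
       then q powi (- int (theta a0 j0 W)) * curly_term X (W3 X a0 j0 W) (m - {#(a0, j0)#}) q
       else 0)"
proof (cases "(a0, j0) \<in># m")
  case False
  \<comment> \<open>The only vacancy number that differs sits at \<open>(a0, j0)\<close>, outside
    the support, so the two summands coincide.\<close>
  then have "(\<Prod>(a, i) \<in> set_mset m. qbinom_curly \<lfloor>vacancy X (W2 a0 j0 W) m a i\<rfloor> (count m (a, i)) q)
    = (\<Prod>(a, i) \<in> set_mset m. qbinom_curly \<lfloor>vacancy X (W1 a0 j0 W) m a i\<rfloor> (count m (a, i)) q)"
    by (intro prod.cong) (auto simp: vacancy_W2[OF assms(2)])
  then show ?thesis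
    using False unfolding if_not_P[OF False]
    by (simp add: curly_term_def charge_W2[OF assms(2)] not_in_iff)
next
  case True
  define m' where "m' = m - {#(a0, j0)#}"
  have m: "m = add_mset (a0, j0) m'" using True by (simp add: m'_def)
  define k where "k = count m' (a0, j0)"
  define S where "S = set_mset m - {(a0, j0)}"
  have S: "finite S" "(a0, j0) \<notin> S" "set_mset m = insert (a0, j0) S"
    using True by (auto simp: S_def)
  define p where "p = \<lfloor>vacancy X (W1 a0 j0 W) m a0 j0\<rfloor>"
  define c where "c = \<lfloor>charge X (W1 a0 j0 W) m\<rfloor>"
  define R where "R = (\<Prod>(a, i) \<in> S. qbinom_curly \<lfloor>vacancy X (W1 a0 j0 W) m a i\<rfloor> (count m (a, i)) q)"
  have sub: "set_mset m' \<subseteq> all_indices X" using assms(3) by (simp add: m)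
  have W1: "curly_term X (W1 a0 j0 W) m q = q powi c * (qbinom_curly p (Suc k) q * R)"
    using S by (simp add: curly_term_def c_def p_def R_def k_def) (simp add: m)
  have "(\<Prod>(a, i) \<in> S. qbinom_curly \<lfloor>vacancy X (W2 a0 j0 W) m a i\<rfloor> (count m (a, i)) q) = R"
    unfolding R_def using S(2) by (intro prod.cong) (auto simp: vacancy_W2[OF assms(2)])
  moreover have "\<lfloor>vacancy X (W2 a0 j0 W) m a0 j0\<rfloor> = p - 1"
    by (simp add: vacancy_W2[OF assms(2)] p_def)
  moreover have "\<lfloor>charge X (W2 a0 j0 W) m\<rfloor> = c + int (Suc k)"
    by (simp add: charge_W2[OF assms(2)] c_def k_def m)
  moreover have "count m (a0, j0) = Suc k" by (simp add: m k_def)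
  ultimately have W2: "curly_term X (W2 a0 j0 W) m q
      = q powi (c + int (Suc k)) * (qbinom_curly (p - 1) (Suc k) q * R)"
    using S by (simp add: curly_term_def)
  have "(\<Prod>(a, i) \<in> S. qbinom_curly \<lfloor>vacancy X (W3 X a0 j0 W) m' a i\<rfloor> (count m' (a, i)) q) = R"
    unfolding R_def
  proof (intro prod.cong refl)
    fix x assume x: "x \<in> S"
    obtain a i where ai: "x = (a, i)" by force
    have "a \<in> nodes X" using x ai assms(3) by (auto simp: S_def all_indices_def)
    moreover have "(a, i) \<noteq> (a0, j0)" using x ai S(2) by auto
    ultimately show "(case x of (a, i) \<Rightarrow> qbinom_curly \<lfloor>vacancy X (W3 X a0 j0 W) m' a i\<rfloor> (count m' (a, i)) q)
      = (case x of (a, i) \<Rightarrow> qbinom_curly \<lfloor>vacancy X (W1 a0 j0 W) m a i\<rfloor> (count m (a, i)) q)"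
      using ai by (auto simp: vacancy_W3[OF assms(1) _ assms(2)] m)
  qed
  moreover have "\<lfloor>vacancy X (W3 X a0 j0 W) m' a0 j0\<rfloor> = p"
    by (simp add: vacancy_W3[OF assms(1,1,2)] p_def m)
  moreover have "\<lfloor>charge X (W3 X a0 j0 W) m'\<rfloor> = c + int (theta a0 j0 W)"
    using floor_diff_of_int[of "charge X (W3 X a0 j0 W) m'" "int (theta a0 j0 W)"]
    by (simp add: c_def m charge_W3[OF assms(1,2) sub])
  \<comment> \<open>The place \<open>(a0, j0)\<close> may have left the support of
    \<open>m'\<close>; its factor is then 1, so the product can keep the index set of
    \<open>m\<close>.\<close>
  moreover have "curly_term X (W3 X a0 j0 W) m' q = q powi \<lfloor>charge X (W3 X a0 j0 W) m'\<rfloor> *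
     (\<Prod>(a, i) \<in> insert (a0, j0) S.
        qbinom_curly \<lfloor>vacancy X (W3 X a0 j0 W) m' a i\<rfloor> (count m' (a, i)) q)"
    by (rule curly_term_superset) (use S in \<open>auto simp: m\<close>)
  ultimately have "curly_term X (W3 X a0 j0 W) m' q
      = q powi (c + int (theta a0 j0 W)) * (qbinom_curly p k q * R)"
    using S by (simp add: k_def)
  then have W3: "q powi (- int (theta a0 j0 W)) * curly_term X (W3 X a0 j0 W) m' q
      = q powi c * (qbinom_curly p k q * R)"
    using power_int_add[OF disjI1[OF q(1)], of "- int (theta a0 j0 W)" "c + int (theta a0 j0 W)"]
    by (simp add: mult.assoc[symmetric])
  have "q ^ Suc k \<noteq> 1" using q(2)[of "Suc k"] by simp
  note pascal = qbinom_curly_pascal[OF q(1) this, of p]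
  have "q powi (c + int (Suc k)) = q powi c * q ^ Suc k"
    using q(1) by (simp only: power_int_add simp_thms disj_not1 power_int_of_nat not_False_eq_True)
  then show ?thesis
    unfolding if_P[OF True] m'_def[symmetric] W1 W2 W3 pascal
    by (simp only: ring_distribs mult_ac)
qed

text \<open>The set \<open>A\<close> is kept arbitrary so that the relation applies both with and
  without sign conditions.\<close>

lemma sum_curly_term:
  fixes q :: "'a::field"
  assumes "finite A" "\<And>m. m \<in> A \<Longrightarrow> set_mset m \<subseteq> all_indices X"
    and "a0 \<in> nodes X" "1 \<le> j0"
    and q: "q \<noteq> 0" "\<And>i. 1 \<le> i \<Longrightarrow> q ^ i \<noteq> 1"
  shows "(\<Sum>m \<in> A. curly_term X (W1 a0 j0 W) m q) = (\<Sum>m \<in> A. curly_term X (W2 a0 j0 W) m q)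
    + q powi (- int (theta a0 j0 W)) *
      (\<Sum>m | add_mset (a0, j0) m \<in> A. curly_term X (W3 X a0 j0 W) m q)"
proof -
  let ?g = "\<lambda>m. curly_term X (W3 X a0 j0 W) m q"
  have "(\<Sum>m \<in> A. curly_term X (W1 a0 j0 W) m q) = (\<Sum>m \<in> A. curly_term X (W2 a0 j0 W) m q
    + q powi (- int (theta a0 j0 W)) *
        (if (a0, j0) \<in># m then ?g (m - {#(a0, j0)#}) else 0))"
    using assms(2) by (intro sum.cong refl)
      (simp add: curly_term_pascal[OF assms(3,4) _ q])
  also have "\<dots> = (\<Sum>m \<in> A. curly_term X (W2 a0 j0 W) m q)
    + q powi (- int (theta a0 j0 W)) * (\<Sum>m | m \<in> A \<and> (a0, j0) \<in># m. ?g (m - {#(a0, j0)#}))"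
    using assms(1) by (simp only: sum.distrib sum.inter_filter flip: sum_distrib_left)
  also have "(\<Sum>m | m \<in> A \<and> (a0, j0) \<in># m. ?g (m - {#(a0, j0)#}))
      = (\<Sum>m | add_mset (a0, j0) m \<in> A. ?g m)"
    by (rule sum.reindex_bij_witness[of _ "add_mset (a0, j0)" "\<lambda>m. m - {#(a0, j0)#}"]) auto
  finally show ?thesis .
qed

section \<open>Weight conditions for the three products\<close>

lemma configurations_W2:
  "1 \<le> j0 \<Longrightarrow> configurations X I (W2 a0 j0 W) lam = configurations X I (W1 a0 j0 W) lam"
  by (auto simp: configurations_def W1_def W2_def factor_def of_nat_diff algebra_simps)

text \<open>At \<open>b = a0\<close> two factors of index \<open>j0\<close> are lost, matching the
  diagonal entry 2. At a neighbour the indices add up to \<open>d * j0\<close> by Hermite's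
  identity, with d minus the Cartan integer.\<close>

lemma weight_W3:
  assumes "a0 \<in> nodes X" "b \<in> nodes X" "1 \<le> j0"
  shows "(\<Sum>(a, i) \<in># W3 X a0 j0 W. of_nat i * fund_weight a b)
    = (\<Sum>(a, i) \<in># W1 a0 j0 W. of_nat i * fund_weight a b) - of_nat j0 * simple_root X a0 b"
proof -
  have eq: "of_nat i * fund_weight a b = (if a = b then of_nat i else 0)" for a i
    by (simp add: fund_weight_def)
  have "simple_root X a0 a0 = 2"
    by (simp add: simple_root_def cartan_def t_form_self)
  moreover have "(if form X a0 b < 0 then \<Sum>k<neg_cartan X a0 b.
        of_nat ((neg_cartan X b a0 * j0 + k) div neg_cartan X a0 b) else 0)
      = - of_nat j0 * simple_root X a0 b" if "b \<noteq> a0"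
  proof (cases "form X a0 b < 0")
    case True
    then show ?thesis
      using that neg_cartan_pos_iff[of a0 b X]
      by (simp add: sum_div_shift simple_root_def of_nat_neg_cartan flip: of_nat_sum)
  next
    case False
    then show ?thesis
      using form_nonpos[of a0 b X] that
      by (simp add: simple_root_def cartan_def form_commute[of X b])
  qed
  moreover have "\<not> form X a0 a0 < 0"
    using sq_length_cases[of X a0] by (auto simp: form_def)
  ultimately show ?thesis
    unfolding eq sum_mset_W3[OF assms(1,2), of of_nat, simplified]
    using assms(3) by (auto simp: W1_def factor_def)
qed

lemma add_mset_in_configurations_iff:
  assumes "a0 \<in> nodes X" "1 \<le> j0" "(a0, j0) \<in> I"
  shows "add_mset (a0, j0) m \<in> configurations X I (W1 a0 j0 W) lam
    \<longleftrightarrow> m \<in> configurations X I (W3 X a0 j0 W) lam"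
  using assms(3) by (auto simp: configurations_def weight_W3[OF assms(1) _ assms(2)] algebra_simps)

lemma finite_level_indices: "finite (level_indices X l)"
proof (rule finite_subset)
  show "level_indices X l \<subseteq> (SIGMA a : nodes X. {..nat \<lfloor>t X a * of_nat l\<rfloor>})"
    by (auto simp: level_indices_def le_nat_iff le_floor_iff)
qed (simp add: nodes_def)

lemma level_indices_subset: "level_indices X l \<subseteq> all_indices X"
  by (auto simp: level_indices_def all_indices_def)

section \<open>Sign conditions on the vacancy numbers\<close>

definition admissible :: "lie_type \<Rightarrow> (nat \<times> nat) set \<Rightarrow> family \<Rightarrow> (nat \<Rightarrow> int) \<Rightarrow> family set" where
  "admissible X I W lam = {m \<in> configurations X I W lam. \<forall>(a, i) \<in> I. 0 \<le> vacancy X W m a i}"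

lemma set_mset_configurations: "m \<in> configurations X I W lam \<Longrightarrow> set_mset m \<subseteq> I"
  by (simp add: configurations_def)

lemma admissible_nonneg: "m \<in> admissible X I W lam \<Longrightarrow> (a, i) \<in># m \<Longrightarrow> 0 \<le> vacancy X W m a i"
  by (fastforce simp: admissible_def configurations_def)

lemma M_eq_sum_curly_term:
  "M X W lam q = (\<Sum>m \<in> admissible X (all_indices X) W lam. curly_term X W m q)"
  unfolding M_def curly_term_def admissible_def[symmetric]
  by (intro sum.cong arg_cong2[where f = "(*)"] prod.cong)
    (auto simp: qbinom_square_def admissible_nonneg)

lemma M_level_eq_sum_curly_term:
  "M_level X l W q = (\<Sum>m \<in> admissible X (level_indices X l) W (\<lambda>_. 0). curly_term X W m q)"
proof -
  have "curly_term X W m q = q powi \<lfloor>charge X W m\<rfloor> *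
        (\<Prod>(a, i) \<in> level_indices X l. qbinom_square \<lfloor>vacancy X W m a i\<rfloor> (count m (a, i)) q)"
    if "m \<in> admissible X (level_indices X l) W (\<lambda>_. 0)" for m
    using that
    by (subst curly_term_superset[OF finite_level_indices[of X l]])
      (auto simp: admissible_def qbinom_square_def dest: set_mset_configurations
        intro!: arg_cong2[where f = "(*)"] prod.cong)
  then show ?thesis
    by (simp add: M_level_def admissible_def)
qed

lemma N_level_eq_sum_curly_term:
  "N_level X l W lam q = (\<Sum>m \<in> configurations X (level_indices X l) W lam. curly_term X W m q)"
  unfolding N_level_def
  by (intro sum.cong refl curly_term_superset[symmetric] finite_level_indices set_mset_configurations)

lemma min_second_diff:
  fixes x y h z :: rat
  shows "min (x - h) z + min (x + h) z \<le> 2 * min x z"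
  by (auto simp: min_def)

text \<open>
  At an unoccupied place the vacancy number is concave in the second index, and the two extra
  factors of \<open>W1\<close> make its second difference at \<open>j0\<close> at most -2.
\<close>

lemma vacancy_pos:
  assumes "1 \<le> j0" "(a0, j0) \<notin># m"
    and "0 \<le> vacancy X (W1 a0 j0 W) m a0 (j0 - 1)" "0 \<le> vacancy X (W1 a0 j0 W) m a0 (j0 + 1)"
  shows "0 < vacancy X (W1 a0 j0 W) m a0 j0"
proof -
  obtain j where j: "j0 = Suc j" using assms(1) by (cases j0) auto
  have "pairing W a0 j + pairing W a0 (j + 2) \<le> 2 * pairing W a0 (j + 1)"
  proof (induction W)
    case (add x W)
    have "of_nat (min j k) + of_nat (min (j + 2) k) \<le> (2 * of_nat (min (j + 1) k) :: rat)" for k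
      by (auto simp: min_def)
    from add this[of "snd x"] show ?case
      by (simp add: pairing_def split_def del: of_nat_min)
  qed (simp add: pairing_def)
  moreover have "gram X m a0 j + gram X m a0 (j + 2) \<ge> 2 * gram X m a0 (j + 1)"
    using assms(2)
  proof (induction m)
    case (add x m)
    obtain b k where x: "x = (b, k)" by force
    have "kernel X a0 j b k + kernel X a0 (j + 2) b k \<ge> 2 * kernel X a0 (j + 1) b k"
    proof (cases "b = a0")
      case True
      \<comment> \<open>Along \<open>a0\<close> itself the kernel is concave, which is the wrong
        direction, but its only kink is at the place \<open>k\<close>, and that place is not
        \<open>j0\<close>.\<close>
      then have "k \<noteq> j + 1" using add.prems x j by auto
      then show ?thesis using True by (auto simp: kernel_self min_def)
    next
      case False
      \<comment> \<open>Off the diagonal, multiplying a concave minimum by the nonpositive form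
        gives the required convexity.\<close>
      have "min (t X b * of_nat j) z + min (t X b * of_nat (j + 2)) z \<le> 2 * min (t X b * of_nat (j + 1)) z" for z
        using min_second_diff[of "t X b * of_nat (j + 1)" "t X b" z] by (simp add: algebra_simps)
      from mult_left_mono_neg[OF this form_nonpos[OF False[symmetric]]]
      show ?thesis by (simp add: kernel_def algebra_simps)
    qed
    then show ?case using add x by (simp add: gram_def)
  qed (simp add: gram_def)
  moreover have "pairing (W1 a0 j0 W) a0 j + pairing (W1 a0 j0 W) a0 (j + 2)
      = pairing W a0 j + pairing W a0 (j + 2) + 2 * of_nat (j + (j + 1))"
    "pairing (W1 a0 j0 W) a0 (j + 1) = pairing W a0 (j + 1) + 2 * of_nat (j + 1)"
    by (simp_all add: pairing_W1 j)
  ultimately show ?thesis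
    using assms(3,4) by (simp add: vacancy_eq j)
qed

text \<open>This is the boundary value for \<open>j0 = 1\<close>, when the left neighbour of
  \<open>(a0, j0)\<close> is not a place of the index set.\<close>

lemma vacancy_0: "vacancy X W m a 0 = 0"
proof -
  have "pairing W a 0 = 0" by (simp add: pairing_def split_def cong: if_cong)
  moreover have "min 0 (t X a * of_nat k) = 0" for k
    using t_pos[of X a] by (simp add: min_def)
  then have "gram X m a 0 = 0" by (simp add: gram_def kernel_def split_def)
  ultimately show ?thesis by (simp add: vacancy_eq)
qed

text \<open>The neighbours of \<open>(a0, j0)\<close> are required in \<open>I\<close> because the
  concavity argument uses their sign conditions.\<close>

lemma sum_admissible_W2:
  assumes "finite (admissible X I (W1 a0 j0 W) lam)" "1 \<le> j0"
    and I: "(a0, j0) \<in> I" "(a0, j0 + 1) \<in> I" "1 < j0 \<Longrightarrow> (a0, j0 - 1) \<in> I"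
  shows "(\<Sum>m \<in> admissible X I (W2 a0 j0 W) lam. curly_term X (W2 a0 j0 W) m q)
    = (\<Sum>m \<in> admissible X I (W1 a0 j0 W) lam. curly_term X (W2 a0 j0 W) m q)"
proof (rule sum.mono_neutral_left[OF assms(1)])
  show "admissible X I (W2 a0 j0 W) lam \<subseteq> admissible X I (W1 a0 j0 W) lam"
    by (fastforce simp: admissible_def configurations_W2[OF assms(2)] vacancy_W2[OF assms(2)]
        split: if_splits)
  show "\<forall>m \<in> admissible X I (W1 a0 j0 W) lam - admissible X I (W2 a0 j0 W) lam.
      curly_term X (W2 a0 j0 W) m q = 0"
  proof
    fix m assume m: "m \<in> admissible X I (W1 a0 j0 W) lam - admissible X I (W2 a0 j0 W) lam"
    let ?v = "vacancy X (W1 a0 j0 W) m"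
    have nonneg: "0 \<le> ?v a i" if "(a, i) \<in> I" for a i
      using m that by (auto simp: admissible_def)
    \<comment> \<open>All other vacancy numbers of \<open>W1\<close> and \<open>W2\<close> agree, so
      the failure is at \<open>(a0, j0)\<close>, where that of \<open>W2\<close> is lower by 1.
      Integrality then forces the value 0 for \<open>W1\<close>.\<close>
    have "?v a0 j0 < 1"
      using m nonneg by (fastforce simp: admissible_def configurations_W2[OF assms(2)] vacancy_W2[OF assms(2)]
          split: if_splits)
    then have v: "?v a0 j0 = 0"
      using nonneg[OF I(1)] vacancy_integer[of X "W1 a0 j0 W" m a0 j0] by (auto elim!: Ints_cases)
    have "0 \<le> ?v a0 (j0 - 1)"
      using nonneg[OF I(3)] assms(2) by (cases "j0 = 1") (auto simp: vacancy_0)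
    then have "(a0, j0) \<in># m"
      using vacancy_pos[OF assms(2), of a0 m X W] nonneg[OF I(2)] v by fastforce
    moreover have "\<lfloor>vacancy X (W2 a0 j0 W) m a0 j0\<rfloor> = - 1"
      by (simp add: vacancy_W2[OF assms(2)] v floor_eq_iff)
    ultimately have "(a0, j0) \<in># m"
      and "qbinom_curly \<lfloor>vacancy X (W2 a0 j0 W) m a0 j0\<rfloor> (count m (a0, j0)) q = 0"
      by (simp_all add: qbinom_curly_minus_one)
    then show "curly_term X (W2 a0 j0 W) m q = 0"
      by (auto simp: curly_term_def intro!: prod_zero bexI[of _ "(a0, j0)"])
  qed
qed

lemma sum_admissible:
  fixes q :: "'a::field"
  assumes "valid_type X" "a0 \<in> nodes X" "1 \<le> j0" "I \<subseteq> all_indices X"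
    and I: "(a0, j0) \<in> I" "(a0, j0 + 1) \<in> I" "1 < j0 \<Longrightarrow> (a0, j0 - 1) \<in> I"
    and q: "q \<noteq> 0" "\<And>i. 1 \<le> i \<Longrightarrow> q ^ i \<noteq> 1"
  shows "(\<Sum>m \<in> admissible X I (W1 a0 j0 W) lam. curly_term X (W1 a0 j0 W) m q)
    = (\<Sum>m \<in> admissible X I (W2 a0 j0 W) lam. curly_term X (W2 a0 j0 W) m q)
      + q powi (- int (theta a0 j0 W)) *
        (\<Sum>m \<in> admissible X I (W3 X a0 j0 W) lam. curly_term X (W3 X a0 j0 W) m q)"
proof -
  have fin: "finite (admissible X I (W1 a0 j0 W) lam)"
    using finite_configurations[OF assms(1,4)] by (simp add: admissible_def)
  have "add_mset (a0, j0) m \<in> admissible X I (W1 a0 j0 W) lam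
      \<longleftrightarrow> m \<in> admissible X I (W3 X a0 j0 W) lam" for m
  proof -
    have "vacancy X (W3 X a0 j0 W) m a i = vacancy X (W1 a0 j0 W) (add_mset (a0, j0) m) a i"
      if "(a, i) \<in> I" for a i
      using that assms(4) by (intro vacancy_W3 assms(2,3)) (auto simp: all_indices_def)
    then have "(\<forall>(a, i) \<in> I. 0 \<le> vacancy X (W3 X a0 j0 W) m a i)
        \<longleftrightarrow> (\<forall>(a, i) \<in> I. 0 \<le> vacancy X (W1 a0 j0 W) (add_mset (a0, j0) m) a i)"
      by (intro ball_cong) auto
    then show ?thesis
      by (simp add: admissible_def add_mset_in_configurations_iff assms(2) assms(3)[simplified] I(1))
  qed
  then have "{m. add_mset (a0, j0) m \<in> admissible X I (W1 a0 j0 W) lam}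
      = admissible X I (W3 X a0 j0 W) lam"
    by blast
  moreover have "set_mset m \<subseteq> all_indices X" if "m \<in> admissible X I (W1 a0 j0 W) lam" for m
    using that assms(4) set_mset_configurations by (fastforce simp: admissible_def)
  ultimately show ?thesis
    using sum_curly_term[OF fin _ assms(2,3) q, of W] sum_admissible_W2[OF fin assms(3) I, of q]
    by simp
qed

lemma sum_configurations:
  fixes q :: "'a::field"
  assumes "valid_type X" "a0 \<in> nodes X" "1 \<le> j0" "I \<subseteq> all_indices X" "(a0, j0) \<in> I"
    and q: "q \<noteq> 0" "\<And>i. 1 \<le> i \<Longrightarrow> q ^ i \<noteq> 1"
  shows "(\<Sum>m \<in> configurations X I (W1 a0 j0 W) lam. curly_term X (W1 a0 j0 W) m q)
    = (\<Sum>m \<in> configurations X I (W2 a0 j0 W) lam. curly_term X (W2 a0 j0 W) m q)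
      + q powi (- int (theta a0 j0 W)) *
        (\<Sum>m \<in> configurations X I (W3 X a0 j0 W) lam. curly_term X (W3 X a0 j0 W) m q)"
proof -
  have "set_mset m \<subseteq> all_indices X" if "m \<in> configurations X I (W1 a0 j0 W) lam" for m
    using that assms(4) set_mset_configurations by blast
  from sum_curly_term[OF finite_configurations[OF assms(1,4)] this assms(2,3) q]
  show ?thesis
    by (simp add: configurations_W2[OF assms(3)] add_mset_in_configurations_iff[OF assms(2,3,5)])
qed

theorem theorem6p1:
  fixes X :: lie_type and a0 j0 :: nat and lam :: "nat \<Rightarrow> int"
    and W :: family and q :: "'a::field"
  assumes "valid_type X"
    and "a0 \<in> nodes X" and "1 \<le> j0"
    and "lam \<in> dominant_weights X"
    and "set_mset W \<subseteq> all_indices X"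
    and "q \<noteq> 0" and "\<And>i. 1 \<le> i \<Longrightarrow> q ^ i \<noteq> 1"
  shows
    "M X (W1 a0 j0 W) lam q
       = M X (W2 a0 j0 W) lam q
         + q powi (- int (theta a0 j0 W)) * M X (W3 X a0 j0 W) lam q
     \<and> (\<forall>l::nat. 1 \<le> l \<and>
          (\<forall>(a, j) \<in> set_mset (W1 a0 j0 W + W2 a0 j0 W + W3 X a0 j0 W).
              of_nat j \<le> t X a * of_nat l) \<longrightarrow>
          M_level X l (W1 a0 j0 W) q
            = M_level X l (W2 a0 j0 W) q
              + q powi (- int (theta a0 j0 W)) * M_level X l (W3 X a0 j0 W) q
          \<and> N_level X l (W1 a0 j0 W) lam q
            = N_level X l (W2 a0 j0 W) lam q
              + q powi (- int (theta a0 j0 W)) * N_level X l (W3 X a0 j0 W) lam q)"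
proof (intro conjI allI impI; (elim conjE)?)
  show "M X (W1 a0 j0 W) lam q = M X (W2 a0 j0 W) lam q
      + q powi (- int (theta a0 j0 W)) * M X (W3 X a0 j0 W) lam q"
    unfolding M_eq_sum_curly_term
    by (rule sum_admissible) (use assms in \<open>auto simp: all_indices_def\<close>)
next
  fix l :: nat
  assume "\<forall>(a, j) \<in> set_mset (W1 a0 j0 W + W2 a0 j0 W + W3 X a0 j0 W).
      of_nat j \<le> t X a * of_nat l"
  \<comment> \<open>This factor brings the right neighbour of \<open>(a0, j0)\<close>, and hence all
    lower places at \<open>a0\<close>, into the level.\<close>
  moreover have "(a0, j0 + 1) \<in># W2 a0 j0 W"
    by (simp add: W2_def factor_def)
  ultimately have "of_nat (j0 + 1) \<le> t X a0 * of_nat l"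
    by fastforce
  then have I: "(a0, j) \<in> level_indices X l" if "1 \<le> j" "j \<le> j0 + 1" for j
    using that assms(2) by (auto simp: level_indices_def elim: order_trans[rotated])
  show "M_level X l (W1 a0 j0 W) q = M_level X l (W2 a0 j0 W) q
      + q powi (- int (theta a0 j0 W)) * M_level X l (W3 X a0 j0 W) q"
    unfolding M_level_eq_sum_curly_term
    by (intro sum_admissible assms level_indices_subset I) (use assms(3) in auto)
  show "N_level X l (W1 a0 j0 W) lam q = N_level X l (W2 a0 j0 W) lam q
      + q powi (- int (theta a0 j0 W)) * N_level X l (W3 X a0 j0 W) lam q"
    unfolding N_level_eq_sum_curly_term
    by (intro sum_configurations assms level_indices_subset I) (use assms(3) in auto)
qed

end
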